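(* Let $\lambda>0$ and let $X$ have the Poisson distribution with parameter $\lambda$, with probability mass function $f(x)=\frac{\lambda^xe^{-\lambda}}{x!}$ for $x\in\{0,1,2,\dots\}$ (and $f(x)=0$ for negative integers $x$) and cumulative distribution function $F$. Then for every integer $r$, the first-order, complementary and second-order loss functions of $X$ are $$L_1(r)=-(r-\lambda)[1-F(r)]+\lambda f(r),$$ $$L_c(r)=(r-\lambda)F(r)+\lambda f(r),$$ $$L_2(r)=\frac12\left([(r-\lambda)^2+r]\,[1-F(r)]-\lambda(r-\lambda)f(r)\right).$$
   Context: For an integer-valued random variable $X$ with probability mass function $f$, the first-order loss function is $L_1(r)=\sum_{x\ge r}(x-r)f(x)$, the complementary loss function is $L_c(r)=\sum_{x\le r}(r-x)f(x)$, and the second-order loss function is $L_2(r)=\frac12\sum_{x\ge r}(x-r)(x-r-1)f(x)$, the sums running over integers $x$ in the range (support) of $X$. The cumulative distribution function is $F(y)=\mathbb{P}(X\le y)$. *)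

theory Defs
  imports "HOL-Probability.Probability"
begin

definition int_mass :: "'a measure \<Rightarrow> ('a \<Rightarrow> int) \<Rightarrow> int \<Rightarrow> real" where
  "int_mass M X x = \<P>(\<omega> in M. X \<omega> = x)"

definition int_cdf :: "'a measure \<Rightarrow> ('a \<Rightarrow> int) \<Rightarrow> int \<Rightarrow> real" where
  "int_cdf M X y = \<P>(\<omega> in M. X \<omega> \<le> y)"

definition int_support :: "'a measure \<Rightarrow> ('a \<Rightarrow> int) \<Rightarrow> int set" where
  "int_support M X = {x. int_mass M X x \<noteq> 0}"

(* All summands below are nonnegative, so the order of summation is irrelevant.
   infsum returns 0 for a divergent series. *)

definition first_order_loss :: "'a measure \<Rightarrow> ('a \<Rightarrow> int) \<Rightarrow> int \<Rightarrow> real" where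
  "first_order_loss M X r =
     (\<Sum>\<^sub>\<infinity>x\<in>{x \<in> int_support M X. r \<le> x}. of_int (x - r) * int_mass M X x)"

definition complementary_loss :: "'a measure \<Rightarrow> ('a \<Rightarrow> int) \<Rightarrow> int \<Rightarrow> real" where
  "complementary_loss M X r =
     (\<Sum>\<^sub>\<infinity>x\<in>{x \<in> int_support M X. x \<le> r}. of_int (r - x) * int_mass M X x)"

definition second_order_loss :: "'a measure \<Rightarrow> ('a \<Rightarrow> int) \<Rightarrow> int \<Rightarrow> real" where
  "second_order_loss M X r =
     1 / 2 * (\<Sum>\<^sub>\<infinity>x\<in>{x \<in> int_support M X. r \<le> x}.
                of_int ((x - r) * (x - r - 1)) * int_mass M X x)"

definition poisson_distributed :: "'a measure \<Rightarrow> real \<Rightarrow> ('a \<Rightarrow> int) \<Rightarrow> bool" where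
  "poisson_distributed M lam X \<longleftrightarrow>
     X \<in> measurable M (count_space UNIV) \<and>
     distr M (count_space UNIV) X = measure_pmf (map_pmf int (poisson_pmf lam))"

lemma int_mass_poisson:
  assumes "0 < lam" and "poisson_distributed M lam X"
  shows "int_mass M X x = (if x < 0 then 0 else lam ^ nat x * exp (- lam) / fact (nat x))"
proof -
  have X: "X \<in> measurable M (count_space UNIV)"
    and D: "distr M (count_space UNIV) X = measure_pmf (map_pmf int (poisson_pmf lam))"
    using assms(2) by (auto simp: poisson_distributed_def)
  have "int_mass M X x = measure M (X -` {x} \<inter> space M)"
    unfolding int_mass_def by (rule arg_cong[where f = "measure M"]) auto
  also have "\<dots> = measure (distr M (count_space UNIV) X) {x}"
    using X by (simp add: measure_distr)
  also have "\<dots> = pmf (map_pmf int (poisson_pmf lam)) x"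
    by (simp add: D pmf.rep_eq)
  also have "\<dots> = (if x < 0 then 0 else lam ^ nat x * exp (- lam) / fact (nat x))"
  proof (cases "x < 0")
    case True
    then have "x \<notin> set_pmf (map_pmf int (poisson_pmf lam))" by auto
    then show ?thesis using True by (simp only: set_pmf_iff) simp
  next
    case False
    then have "pmf (map_pmf int (poisson_pmf lam)) (int (nat x)) = pmf (poisson_pmf lam) (nat x)"
      by (intro pmf_map_inj') (auto simp: inj_on_def)
    then show ?thesis using False assms(1) by simp
  qed
  finally show ?thesis .
qed

end

theory Submission
  imports Defs
begin

text \<open>
  The Poisson mass function satisfies \<open>x f(x) = \<lambda> f(x - 1)\<close> on all integers, so weighting by \<open>x\<close>
  amounts to shifting the index. Writing the weights in terms of \<open>1\<close>, \<open>x\<close> and \<open>x (x - 1)\<close> expresses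
  each loss function through tail or cumulative probabilities at \<open>r\<close>, \<open>r - 1\<close> and \<open>r - 2\<close>; these
  differ by values of \<open>f\<close> near \<open>r\<close>, which the same recurrence reduces to \<open>f(r)\<close>.
\<close>

text \<open>Bridges two summation theories: the measure of a set is available as an
  \<open>infsetsum\<close>, and absolute summability of \<open>pmf p\<close> carries it over to
  \<open>has_sum\<close>.\<close>

lemma has_sum_pmf: "(pmf p has_sum measure (measure_pmf p) A) A"
proof -
  have "pmf p summable_on A"
    using pmf_abs_summable[of p A]
    by (metis Infinite_Set_Sum.abs_summable_equivalent abs_summable_summable)
  moreover have "infsum (pmf p) A = measure (measure_pmf p) A"
    by (simp add: measure_pmf_conv_infsetsum infsetsum_infsum pmf_abs_summable)
  ultimately show ?thesis
    by (simp add: has_sum_iff)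
qed

text \<open>Translation is injective, so the sum can be reindexed. This moves the shift produced by
  the mass recurrence from the summand to the index set.\<close>

lemma has_sum_shift_int:
  fixes g :: "int \<Rightarrow> real"
  assumes "(g has_sum s) ((\<lambda>x. x - k) ` A)"
  shows "((\<lambda>x. g (x - k)) has_sum s) A"
  using assms by (subst (asm) has_sum_reindex) (auto simp: o_def inj_on_def)

context
  fixes M :: "'a measure" and X :: "'a \<Rightarrow> int" and lam :: real
  assumes pos: "0 < lam" and poisson: "poisson_distributed M lam X"
begin

text \<open>Both quantities depend only on the law of \<open>X\<close>, so the problem moves to a
  concrete pmf on the integers, where \<open>has_sum_pmf\<close> applies.\<close>

lemma int_mass_eq_pmf: "int_mass M X = pmf (map_pmf int (poisson_pmf lam))"
  and int_cdf_eq_measure: "int_cdf M X k = measure (map_pmf int (poisson_pmf lam)) {..k}"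
proof -
  have X: "X \<in> measurable M (count_space UNIV)"
    and D: "distr M (count_space UNIV) X = measure_pmf (map_pmf int (poisson_pmf lam))"
    using poisson by (auto simp: poisson_distributed_def)
  have *: "measure (map_pmf int (poisson_pmf lam)) A = measure M (X -` A \<inter> space M)" for A
    unfolding D[symmetric] using X by (simp add: measure_distr)
  show "int_mass M X = pmf (map_pmf int (poisson_pmf lam))"
    unfolding int_mass_def pmf.rep_eq *
    by (intro ext arg_cong[where f = "measure M"]) auto
  show "int_cdf M X k = measure (map_pmf int (poisson_pmf lam)) {..k}"
    unfolding int_cdf_def * by (intro arg_cong[where f = "measure M"]) auto
qed

lemma has_sum_mass_atMost: "(int_mass M X has_sum int_cdf M X k) {..k}"
  unfolding int_mass_eq_pmf int_cdf_eq_measure by (rule has_sum_pmf)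

lemma has_sum_mass_greaterThan: "(int_mass M X has_sum (1 - int_cdf M X k)) {k<..}"
proof -
  have "measure (map_pmf int (poisson_pmf lam)) {k<..} = 1 - int_cdf M X k"
    unfolding int_cdf_eq_measure
    using measure_pmf.prob_compl[of "{..k}" "map_pmf int (poisson_pmf lam)"]
    by (simp add: Compl_eq_Diff_UNIV[symmetric])
  then show ?thesis
    unfolding int_mass_eq_pmf by (metis has_sum_pmf)
qed

lemma int_cdf_diff_1: "int_cdf M X (k - 1) = int_cdf M X k - int_mass M X k"
proof -
  have "((int_mass M X) has_sum (int_mass M X k + int_cdf M X (k - 1))) (insert k {..k - 1})"
    by (intro has_sum_insert has_sum_mass_atMost) auto
  moreover have "insert k {..k - 1} = {..k}" by auto
  ultimately show ?thesis
    using has_sum_mass_atMost[of k] has_sum_unique by fastforce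
qed

text \<open>For positive \<open>x\<close> the factor \<open>x\<close> cancels against the factorial,
  leaving one power of \<open>lam\<close> to split off.\<close>

lemma mass_recurrence: "of_int x * int_mass M X x = lam * int_mass M X (x - 1)"
proof (cases "x \<le> 0")
  \<comment> \<open>Both sides vanish: \<open>x - 1\<close> is negative and has no mass, and on the
    left either \<open>x = 0\<close> or \<open>x\<close> itself is negative.\<close>
  case True
  then show ?thesis by (auto simp: int_mass_poisson[OF pos poisson])
next
  case False
  then obtain n where "x = int (Suc n)"
    by (metis not_le zero_less_imp_eq_int gr0_conv_Suc)
  then have "of_int x * int_mass M X x = real (Suc n) * (lam ^ Suc n * exp (- lam) / fact (Suc n))"
    by (simp add: int_mass_poisson[OF pos poisson] nat_add_distrib)
  also have "\<dots> = lam * (lam ^ n * exp (- lam) / fact n)"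
    by (simp del: of_nat_Suc)
  also have "\<dots> = lam * int_mass M X (x - 1)"
    using \<open>x = int (Suc n)\<close> by (simp add: int_mass_poisson[OF pos poisson])
  finally show ?thesis .
qed

lemma mass_recurrence2: "of_int (x * (x - 1)) * int_mass M X x = lam\<^sup>2 * int_mass M X (x - 2)"
proof -
  have "of_int (x * (x - 1)) * int_mass M X x
      = of_int (x - 1) * (of_int x * int_mass M X x)"
    by simp
  also have "\<dots> = lam * (of_int (x - 1) * int_mass M X (x - 1))"
    by (subst mass_recurrence) simp
  also have "\<dots> = lam\<^sup>2 * int_mass M X (x - 2)"
    unfolding mass_recurrence[of "x - 1"] by (simp add: power2_eq_square)
  finally show ?thesis .
qed

text \<open>After rewriting by the recurrence, the index shift by 1 turns \<open>{..k}\<close> into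
  \<open>{..k - 1}\<close>.\<close>

lemma has_sum_moment_atMost:
  "((\<lambda>x. of_int x * int_mass M X x) has_sum lam * int_cdf M X (k - 1)) {..k}"
proof -
  have "(\<lambda>x. x - 1) ` {..k} = {..k - 1}" by (auto intro: image_eqI[of _ _ "_ + 1"])
  then show ?thesis
    unfolding mass_recurrence
    by (intro has_sum_cmult_right has_sum_shift_int) (simp add: has_sum_mass_atMost)
qed

lemma image_diff_greaterThan_int: "(\<lambda>x. x - j) ` {k<..} = {k - j<..}" for j k :: int
proof -
  have "x \<in> (\<lambda>x. x - j) ` {k<..}" if "k - j < x" for x
    using that by (intro image_eqI[of _ _ "x + j"]) auto
  then show ?thesis by auto
qed

lemma has_sum_moment_greaterThan:
  "((\<lambda>x. of_int x * int_mass M X x) has_sum lam * (1 - int_cdf M X (k - 1))) {k<..}"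
  unfolding mass_recurrence
  by (intro has_sum_cmult_right has_sum_shift_int)
    (simp only: image_diff_greaterThan_int has_sum_mass_greaterThan)

lemma has_sum_moment2_greaterThan:
  "((\<lambda>x. of_int (x * (x - 1)) * int_mass M X x) has_sum lam\<^sup>2 * (1 - int_cdf M X (k - 2))) {k<..}"
  unfolding mass_recurrence2
  by (intro has_sum_cmult_right has_sum_shift_int)
    (simp only: image_diff_greaterThan_int has_sum_mass_greaterThan)

lemma first_order_loss_poisson:
  "first_order_loss M X r = - (of_int r - lam) * (1 - int_cdf M X r) + lam * int_mass M X r"
proof -
  let ?f = "int_mass M X" and ?F = "int_cdf M X"
  have "((\<lambda>x. of_int x * ?f x + - of_int r * ?f x) has_sum
      lam * (1 - ?F (r - 1)) + - of_int r * (1 - ?F r)) {r<..}"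
    by (intro has_sum_add has_sum_cmult_right has_sum_moment_greaterThan has_sum_mass_greaterThan)
  \<comment> \<open>The two index sets differ only at \<open>x = r\<close>, where the weight is 0,
    and at points off the support, where the mass is 0. Using \<open>{r<..}\<close> makes the plain
    tail exactly \<open>1 - ?F r\<close>.\<close>
  also have "?this \<longleftrightarrow> ((\<lambda>x. of_int (x - r) * ?f x) has_sum
      lam * (1 - ?F (r - 1)) + - of_int r * (1 - ?F r)) {x \<in> int_support M X. r \<le> x}"
    by (intro has_sum_cong_neutral) (auto simp: int_support_def algebra_simps)
  \<comment> \<open>Convergence is part of \<open>has_sum\<close>, so the default value of
    \<open>infsum\<close> does not enter. The term \<open>lam * ?f r\<close> comes from
    \<open>?F (r - 1) = ?F r - ?f r\<close>.\<close>
  finally show ?thesis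
    unfolding first_order_loss_def
    by (subst infsumI, assumption) (simp add: int_cdf_diff_1 algebra_simps)
qed

lemma complementary_loss_poisson:
  "complementary_loss M X r = (of_int r - lam) * int_cdf M X r + lam * int_mass M X r"
proof -
  let ?f = "int_mass M X" and ?F = "int_cdf M X"
  have "((\<lambda>x. of_int r * ?f x + (-1) * (of_int x * ?f x)) has_sum
      of_int r * ?F r + (-1) * (lam * ?F (r - 1))) {..r}"
    by (intro has_sum_add has_sum_cmult_right has_sum_moment_atMost has_sum_mass_atMost)
  also have "?this \<longleftrightarrow> ((\<lambda>x. of_int (r - x) * ?f x) has_sum
      of_int r * ?F r + (-1) * (lam * ?F (r - 1))) {x \<in> int_support M X. x \<le> r}"
    by (intro has_sum_cong_neutral) (auto simp: int_support_def algebra_simps)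
  finally show ?thesis
    unfolding complementary_loss_def
    by (subst infsumI, assumption) (simp add: int_cdf_diff_1 algebra_simps)
qed

lemma second_order_loss_poisson:
  "second_order_loss M X r =
    1 / 2 * (((of_int r - lam)\<^sup>2 + of_int r) * (1 - int_cdf M X r)
      - lam * (of_int r - lam) * int_mass M X r)"
proof -
  let ?f = "int_mass M X" and ?F = "int_cdf M X"
  \<comment> \<open>The coefficients come from (x - r)(x - r - 1) = x(x - 1) - 2rx + r(r +
    1).\<close>
  let ?S = "lam\<^sup>2 * (1 - ?F (r - 2)) + (- 2 * of_int r) * (lam * (1 - ?F (r - 1)))
      + of_int (r * (r + 1)) * (1 - ?F r)"
  have "((\<lambda>x. of_int (x * (x - 1)) * ?f x + (- 2 * of_int r) * (of_int x * ?f x)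
      + of_int (r * (r + 1)) * ?f x) has_sum ?S) {r<..}"
    by (intro has_sum_add has_sum_cmult_right has_sum_moment2_greaterThan
        has_sum_moment_greaterThan has_sum_mass_greaterThan)
  also have "?this \<longleftrightarrow> ((\<lambda>x. of_int ((x - r) * (x - r - 1)) * ?f x) has_sum ?S)
      {x \<in> int_support M X. r \<le> x}"
    by (intro has_sum_cong_neutral) (auto simp: int_support_def algebra_simps)
  finally have "second_order_loss M X r = 1 / 2 * ?S"
    unfolding second_order_loss_def by (subst infsumI, assumption) simp
  \<comment> \<open>Removing the masses at \<open>r\<close> and \<open>r - 1\<close> from
    \<open>?F r\<close> leaves \<open>?F (r - 2)\<close>; one factor \<open>lam\<close> then turns
    \<open>lam * ?f (r - 1)\<close> into \<open>of_int r * ?f r\<close>, with no division by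
    \<open>lam\<close>.\<close>
  moreover have "lam\<^sup>2 * ?F (r - 2) = lam\<^sup>2 * (?F r - ?f r) - lam * (of_int r * ?f r)"
    using int_cdf_diff_1[of "r - 1"] int_cdf_diff_1[of r] mass_recurrence[of r]
    by (simp add: power2_eq_square right_diff_distrib)
  ultimately show ?thesis
    unfolding right_diff_distrib int_cdf_diff_1 by (simp add: field_simps power2_eq_square)
qed

end

theorem mainTheorem4:
  fixes M :: "'a measure" and X :: "'a \<Rightarrow> int" and lam :: real and f F :: "int \<Rightarrow> real" and r :: int
  assumes "prob_space M"
    and "0 < lam"
    and "poisson_distributed M lam X"
    and "f = int_mass M X"
    and "F = int_cdf M X"
  shows "first_order_loss M X r = - (of_int r - lam) * (1 - F r) + lam * f r \<and>
    complementary_loss M X r = (of_int r - lam) * F r + lam * f r \<and>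
    second_order_loss M X r =
      1 / 2 * (((of_int r - lam)\<^sup>2 + of_int r) * (1 - F r) - lam * (of_int r - lam) * f r)"
  using first_order_loss_poisson[OF assms(2,3)] complementary_loss_poisson[OF assms(2,3)]
    second_order_loss_poisson[OF assms(2,3)]
  unfolding assms(4,5) by blast

end
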